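(* Let $\mathcal D$ be a doctrine on a finite set of literals $\Pi$, and for a valuation $v$ let $v^*$ denote its upper revised valuation with respect to $\mathcal D$. The transformation $v\mapsto v^*$ from $[0,1]^\Pi$ to $[0,1]^\Pi$ has the following properties: (a) it is continuous; (b) for any valuations $v,w$, $v\le w$ implies $v^*\le w^*$; (c) $v\le v^*$ for every valuation $v$; (d) for every valuation $v$, the image set $\{v^*_p : p\in\Pi\}$ is contained in the image set $\{v_p : p\in\Pi\}$.
   Context: $\Pi_+$ is a finite nonempty set of atoms; $\Pi=\bigcup_{p\in\Pi_+}\{p,\overline p\}$ is the set of literals, where $p\mapsto\overline p$ is negation and $\overline{\overline p}=p$. A clause is a subset $C\subseteq\Pi$, read as the disjunction $\bigvee_{p\in C}p$. A doctrine is a collection $\mathcal D$ of clauses, read as the conjunctive normal form $\bigwedge_{C\in\mathcal D}\bigvee_{p\in C}p$. Standing assumptions: (D1) this formula is satisfiable; (D2) no clause in $\mathcal D$ consists of a single literal; (D3) $\{p,\overline p\}\in\mathcal D$ for every $p\in\Pi_+$. A valuation is a map $w:\Pi\to[0,1]$, $p\mapsto w_p$; $v\le w$ means $v_p\le w_p$ for all $p\in\Pi$. For a valuation $v$ define $v'$ by $$v'_p=\max_{C\in\mathcal D,\ C\ni p}\ \min_{\alpha\in C,\ \alpha\neq p} v_{\overline\alpha}.$$ Put $v^{(0)}=v$ and $v^{(n+1)}=(v^{(n)})'$. This sequence is non-decreasing and takes values in the finite set $\{v_\alpha:\alpha\in\Pi\}$, so it is eventually constant; its eventual value is the upper revised valuation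 $v^*$. *)

theory Defs
  imports "HOL-Analysis.Function_Topology"
begin

text \<open>The finite nonempty set of atoms is the type \<^typ>\<open>'a\<close> of class \<^class>\<open>finite\<close>;
  the set of literals is the type \<open>'a lit\<close>.\<close>

datatype 'a lit = Pos 'a | Neg 'a

instance lit :: (finite) finite
proof
  have "(UNIV :: 'a lit set) = range Pos \<union> range Neg"
    by (metis UNIV_eq_I UnI1 UnI2 lit.exhaust rangeI)
  then show "finite (UNIV :: 'a lit set)"
    by (metis finite_Un finite_imageI finite_class.finite_UNIV)
qed

primrec neg :: "'a lit \<Rightarrow> 'a lit" where
  "neg (Pos a) = Neg a"
| "neg (Neg a) = Pos a"

type_synonym 'a clause = "'a lit set"

primrec lit_true :: "('a \<Rightarrow> bool) \<Rightarrow> 'a lit \<Rightarrow> bool" where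
  "lit_true s (Pos a) \<longleftrightarrow> s a"
| "lit_true s (Neg a) \<longleftrightarrow> \<not> s a"

definition satisfiable :: "'a clause set \<Rightarrow> bool" where
  "satisfiable D \<longleftrightarrow> (\<exists>s. \<forall>C\<in>D. \<exists>p\<in>C. lit_true s p)"

definition doctrine :: "'a clause set \<Rightarrow> bool" where
  "doctrine D \<longleftrightarrow>
     satisfiable D \<and>
     (\<forall>p. {p} \<notin> D) \<and>
     (\<forall>a. {Pos a, neg (Pos a)} \<in> D)"

definition valuations :: "('a lit \<Rightarrow> real) set" where
  "valuations = {v. \<forall>p. 0 \<le> v p \<and> v p \<le> 1}"

text \<open>For a doctrine, both sets below are finite and nonempty: a clause containing \<open>p\<close>
  has a further literal, and \<open>p\<close> lies in the clause \<open>{p, neg p}\<close>.\<close>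

definition revise :: "'a clause set \<Rightarrow> ('a::finite lit \<Rightarrow> real) \<Rightarrow> 'a lit \<Rightarrow> real" where
  "revise D v p = Max {Min {v (neg \<alpha>) | \<alpha>. \<alpha> \<in> C \<and> \<alpha> \<noteq> p} | C. C \<in> D \<and> p \<in> C}"

text \<open>The eventual value of the sequence of iterates; it exists when \<open>D\<close> is a doctrine, and
  it is unique whenever it exists.\<close>

definition upper_revised :: "'a clause set \<Rightarrow> ('a::finite lit \<Rightarrow> real) \<Rightarrow> 'a lit \<Rightarrow> real" where
  "upper_revised D v = (THE u. \<forall>\<^sub>F n in sequentially. (revise D ^^ n) v = u)"

end

(* The key estimate is that v \<le> w + e (coordinatewise, e a constant) implies v' \<le> w' + e, because
   max and min are monotone and commute with adding a constant. It passes to iterates and hence to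
   v*: the number of steps until stabilisation may differ for v and w, but any step that is late
   enough for both computes both values. The case e = 0 is monotonicity, and exchanging v and w
   shows that v* is 1-Lipschitz in the maximum metric, hence continuous. *)

theory Submission
  imports Defs
begin

text \<open>The degree to which \<open>C\<close> forces \<open>p\<close>, as in unit propagation:
  every other literal of \<open>C\<close> is refuted at least to this degree.\<close>

definition clause_value :: "('a::finite lit \<Rightarrow> real) \<Rightarrow> 'a lit \<Rightarrow> 'a clause \<Rightarrow> real" where
  "clause_value v p C = Min {v (neg \<alpha>) | \<alpha>. \<alpha> \<in> C \<and> \<alpha> \<noteq> p}"

lemma neg_neg [simp]: "neg (neg p) = p"
  by (cases p) auto

lemma clause_value_le:
  assumes "\<alpha> \<in> C" "\<alpha> \<noteq> p"
  shows "clause_value v p C \<le> v (neg \<alpha>)"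
  unfolding clause_value_def using assms by (intro Min_le) auto

lemma revise_eq: "revise D v p = Max (clause_value v p ` {C \<in> D. p \<in> C})"
  unfolding revise_def clause_value_def by (rule arg_cong[of _ _ Max]) auto

lemma clause_value_le_revise:
  assumes "C \<in> D" "p \<in> C"
  shows "clause_value v p C \<le> revise D v p"
  unfolding revise_eq using assms by (intro Max_ge) auto

context
  fixes D :: "'a::finite clause set"
  assumes D: "doctrine D"
begin

lemma excluded_middle_clause: "{p, neg p} \<in> D"
  using D by (cases p) (auto simp: doctrine_def insert_commute)

text \<open>Since \<open>{p}\<close> is not a clause, \<open>C\<close> has a literal other than
  \<open>p\<close>, so the minimum runs over a nonempty finite set and is one of its values.\<close>

lemma clause_value_attained:
  assumes "C \<in> D" "p \<in> C"
  obtains \<alpha> where "\<alpha> \<in> C" "\<alpha> \<noteq> p" "clause_value v p C = v (neg \<alpha>)"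
proof -
  have "C \<noteq> {p}"
    using D assms by (auto simp: doctrine_def)
  then have "{v (neg \<alpha>) | \<alpha>. \<alpha> \<in> C \<and> \<alpha> \<noteq> p} \<noteq> {}"
    using assms by auto
  then have "clause_value v p C \<in> {v (neg \<alpha>) | \<alpha>. \<alpha> \<in> C \<and> \<alpha> \<noteq> p}"
    unfolding clause_value_def by (intro Min_in) auto
  with that show thesis by blast
qed

text \<open>The clause \<open>{p, neg p}\<close> keeps the maximum from running over the empty
  set.\<close>

lemma revise_attained:
  obtains C where "C \<in> D" "p \<in> C" "revise D v p = clause_value v p C"
proof -
  have "revise D v p \<in> clause_value v p ` {C \<in> D. p \<in> C}"
    unfolding revise_eq using excluded_middle_clause[of p] by (intro Max_in) auto
  with that show thesis by auto
qed

lemma range_revise: "range (revise D v) \<subseteq> range v"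
proof clarify
  fix p
  obtain C where "C \<in> D" "p \<in> C" "revise D v p = clause_value v p C"
    by (rule revise_attained)
  moreover from this(1,2) obtain \<alpha> where "clause_value v p C = v (neg \<alpha>)"
    by (rule clause_value_attained)
  ultimately show "revise D v p \<in> range v"
    by simp
qed

lemma le_revise: "v \<le> revise D v"
proof (rule le_funI)
  fix p
  obtain \<alpha> where "\<alpha> \<in> {p, neg p}" "\<alpha> \<noteq> p" "clause_value v p {p, neg p} = v (neg \<alpha>)"
    using clause_value_attained[OF excluded_middle_clause] by blast
  \<comment> \<open>The only admissible literal is \<open>neg p\<close>, whose negation is
    \<open>p\<close>: this clause passes the old value of \<open>p\<close> on to its
    revision.\<close>
  then have "clause_value v p {p, neg p} = v p"
    by auto
  then show "v p \<le> revise D v p"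
    using clause_value_le_revise[OF excluded_middle_clause, of p p v] by simp
qed

lemma revise_le_add:
  assumes "\<And>q. v q \<le> w q + e"
  shows "revise D v p \<le> revise D w p + e"
proof -
  \<comment> \<open>The witnesses come from opposite sides: \<open>C\<close> attains the maximum for
    \<open>v\<close>, and within this \<open>C\<close>, \<open>\<alpha>\<close> attains the minimum
    for \<open>w\<close>. What remains are the plain bounds for \<open>Min\<close> and
    \<open>Max\<close>.\<close>
  obtain C where C: "C \<in> D" "p \<in> C" "revise D v p = clause_value v p C"
    by (rule revise_attained)
  obtain \<alpha> where \<alpha>: "\<alpha> \<in> C" "\<alpha> \<noteq> p" "clause_value w p C = w (neg \<alpha>)"
    using clause_value_attained[OF C(1,2)] by blast
  have "revise D v p \<le> v (neg \<alpha>)"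
    using clause_value_le[OF \<alpha>(1,2)] C(3) by simp
  also have "\<dots> \<le> clause_value w p C + e"
    using assms \<alpha>(3) by simp
  also have "\<dots> \<le> revise D w p + e"
    using clause_value_le_revise[OF C(1,2)] by simp
  finally show ?thesis .
qed

lemma range_funpow_revise: "range ((revise D ^^ n) v) \<subseteq> range v"
  by (induction n) (use range_revise in fastforce)+

lemma mono_funpow_revise: "mono (\<lambda>n. (revise D ^^ n) v)"
  by (simp add: mono_iff_le_Suc le_revise)

lemma funpow_revise_le_add:
  assumes "\<And>q. v q \<le> w q + e"
  shows "(revise D ^^ n) v p \<le> (revise D ^^ n) w p + e"
  by (induction n arbitrary: p) (simp_all add: assms revise_le_add)

text \<open>All iterates map the finite set of literals into the finite set \<open>range v\<close>,
  so only finitely many functions occur and an increasing sequence of them must become constant.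
  This gives the \<open>THE\<close> in the definition its meaning.\<close>

lemma eventually_upper_revised:
  "\<forall>\<^sub>F n in sequentially. (revise D ^^ n) v = upper_revised D v"
proof -
  let ?f = "\<lambda>n. (revise D ^^ n) v"
  let ?stable = "\<lambda>u. \<forall>\<^sub>F n in sequentially. ?f n = u"
  have "range ?f \<subseteq> PiE UNIV (\<lambda>_. range v)"
    using range_funpow_revise by fastforce
  then have "finite (range ?f)"
    by (rule finite_subset) (simp add: finite_PiE)
  then obtain N where N: "\<And>n. ?f N \<le> ?f n \<Longrightarrow> ?f N = ?f n"
    using finite_has_maximal[of "range ?f"] by auto
  \<comment> \<open>By monotonicity each later iterate lies above the maximal one, hence equals
    it.\<close>
  have stable: "?stable (?f N)"
    unfolding eventually_sequentially
    using N[OF monoD[OF mono_funpow_revise], symmetric] by blast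
  \<comment> \<open>Two eventual values are both attained at some common index, hence equal.\<close>
  moreover have "u = ?f N" if "?stable u" for u
    using eventually_happens'[OF sequentially_bot eventually_conj[OF that stable]] by auto
  ultimately show ?thesis
    unfolding upper_revised_def by (rule theI)
qed

lemma upper_revised_eq_funpow2:
  obtains n where "upper_revised D v = (revise D ^^ n) v" "upper_revised D w = (revise D ^^ n) w"
proof -
  obtain n where "(revise D ^^ n) v = upper_revised D v \<and> (revise D ^^ n) w = upper_revised D w"
    using eventually_happens'[OF sequentially_bot
        eventually_conj[OF eventually_upper_revised[of v] eventually_upper_revised[of w]]]
    by blast
  then show thesis
    by (intro that[of n]) simp_all
qed

lemma range_upper_revised: "range (upper_revised D v) \<subseteq> range v"
proof -
  obtain n where "upper_revised D v = (revise D ^^ n) v"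
    by (rule upper_revised_eq_funpow2)
  then show ?thesis
    using range_funpow_revise[of n v] by simp
qed

lemma le_upper_revised: "v \<le> upper_revised D v"
proof -
  obtain n where "upper_revised D v = (revise D ^^ n) v"
    by (rule upper_revised_eq_funpow2)
  \<comment> \<open>The iterate of index 0 is \<open>v\<close> itself.\<close>
  then show ?thesis
    using monoD[OF mono_funpow_revise, of 0 n v] by simp
qed

lemma upper_revised_le_add:
  assumes "\<And>q. v q \<le> w q + e"
  shows "upper_revised D v p \<le> upper_revised D w p + e"
proof -
  obtain n where "upper_revised D v = (revise D ^^ n) v" "upper_revised D w = (revise D ^^ n) w"
    by (rule upper_revised_eq_funpow2)
  then show ?thesis
    using funpow_revise_le_add[OF assms] by simp
qed

lemma mono_upper_revised: "mono (upper_revised D)"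
proof (rule monoI, rule le_funI)
  fix v w :: "'a lit \<Rightarrow> real" and p
  assume "v \<le> w"
  then show "upper_revised D v p \<le> upper_revised D w p"
    using upper_revised_le_add[of v w 0 p] by (simp add: le_fun_def)
qed

lemma dist_upper_revised_le:
  assumes "\<And>q. dist (v q) (w q) \<le> e"
  shows "dist (upper_revised D v p) (upper_revised D w p) \<le> e"
proof -
  have "v q \<le> w q + e" "w q \<le> v q + e" for q
    using assms[of q] by (auto simp: dist_real_def)
  then have "upper_revised D v p \<le> upper_revised D w p + e"
    "upper_revised D w p \<le> upper_revised D v p + e"
    by (auto intro: upper_revised_le_add)
  then show ?thesis
    by (auto simp: dist_real_def)
qed

lemma continuous_on_upper_revised: "continuous_on S (upper_revised D)"
proof (rule continuous_on_coordinatewise_then_product)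
  fix p
  show "continuous_on S (\<lambda>v. upper_revised D v p)"
    unfolding continuous_on_def
  proof (intro ballI tendstoI)
    fix v and e :: real
    assume "v \<in> S" "0 < e"
    \<comment> \<open>Half of \<open>e\<close> is used because the Lipschitz bound is not
      strict.\<close>
    have "\<forall>\<^sub>F w in at v within S. dist (w q) (v q) < e / 2" for q
      using continuous_on_subset[OF continuous_on_product_coordinates[of q] subset_UNIV, of S]
        \<open>v \<in> S\<close> \<open>0 < e\<close>
      by (intro tendstoD) (auto simp: continuous_on_def)
    \<comment> \<open>With finitely many literals, closeness in each coordinate of the product
      topology becomes closeness in all of them at once, as the Lipschitz bound requires.\<close>
    then have "\<forall>\<^sub>F w in at v within S. \<forall>q. dist (w q) (v q) < e / 2"
      by (rule eventually_all_finite)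
    then show "\<forall>\<^sub>F w in at v within S. dist (upper_revised D w p) (upper_revised D v p) < e"
    proof eventually_elim
      case (elim w)
      then have "dist (upper_revised D w p) (upper_revised D v p) \<le> e / 2"
        by (intro dist_upper_revised_le less_imp_le) simp
      with \<open>0 < e\<close> show ?case by simp
    qed
  qed
qed

end

theorem theorem3p2:
  fixes D :: "'a::finite clause set"
  assumes "doctrine D"
  shows "upper_revised D ` valuations \<subseteq> valuations
    \<and> continuous_on valuations (upper_revised D)
    \<and> (\<forall>v\<in>valuations. \<forall>w\<in>valuations. v \<le> w \<longrightarrow> upper_revised D v \<le> upper_revised D w)
    \<and> (\<forall>v\<in>valuations. v \<le> upper_revised D v)
    \<and> (\<forall>v\<in>valuations. range (upper_revised D v) \<subseteq> range v)"
proof (intro conjI ballI impI)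
  \<comment> \<open>Being a valuation depends on the range alone, so \<open>valuations\<close> is
    preserved by the range inclusion (d).\<close>
  have valuations_iff: "u \<in> valuations \<longleftrightarrow> range u \<subseteq> {0..1}" for u :: "'a lit \<Rightarrow> real"
    by (auto simp: valuations_def image_subset_iff)
  show "upper_revised D ` valuations \<subseteq> valuations"
  proof (rule image_subsetI)
    fix v :: "'a lit \<Rightarrow> real"
    assume "v \<in> valuations"
    then show "upper_revised D v \<in> valuations"
      unfolding valuations_iff using range_upper_revised[OF assms] by blast
  qed
qed (assumption | rule continuous_on_upper_revised monoD[OF mono_upper_revised]
      le_upper_revised range_upper_revised assms)+

end
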